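(* Let $P\subseteq\mathbb{R}^2$ be a lattice polygon and let $X$ be the associated projective toric surface, viewed as an affine cone in $\mathbb{A}^N$ with one coordinate for each lattice point of $P$. If $P$ contains a lattice polygon that is a translate of the convex hull of $\{(0,0),(2,0),(0,2)\}$, then $M(X^{\{2\}})\neq 2M(X)$.
   Context: Work over $\mathbb{C}$. For a lattice polytope $P$ with lattice points $m_1,\ldots,m_N$, the toric variety $X=X_P$ is the Zariski closure of the image of the torus under the monomial map $t\mapsto (t^{m_1},\ldots,t^{m_N})$, taken as an affine cone (equivalently the cone over the corresponding projective toric variety in $\mathbb{P}^{N-1}$); coordinate $z_j$ corresponds to lattice point $m_j$. The secant variety is $X^{\{2\}}=\overline{\{x_1+x_2: x_i\in X\}}$. The algebraic matroid $M(Y)$ of an irreducible variety $Y\subseteq\mathbb{A}^N$ is the matroid on $\{z_1,\ldots,z_N\}$ in which $E$ is independent iff $\mathcal{I}(Y)\cap\mathbb{C}[E]=\langle0\rangle$. $2M$ denotes the matroid union $M\vee M$, whose independent sets are unions of two independent sets of $M$. *)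

theory Defs
  imports "HOL-Analysis.Analysis" "HOL-Library.Poly_Mapping"
begin

text \<open>The affine space with coordinates indexed by a set \<open>I\<close> consists of the functions that
  vanish off \<open>I\<close>.\<close>

definition affine_space :: "'i set \<Rightarrow> ('i \<Rightarrow> complex) set" where
  "affine_space I = {x. \<forall>i. i \<notin> I \<longrightarrow> x i = 0}"

text \<open>A polynomial is a finitely supported function from monomials to coefficients, and a monomial
  is a finitely supported function from variables to exponents; the ring structure is the
  convolution product of \<^theory>\<open>HOL-Library.Poly_Mapping\<close>.\<close>

type_synonym 'i mpoly = "('i \<Rightarrow>\<^sub>0 nat) \<Rightarrow>\<^sub>0 complex"

definition poly_eval :: "'i mpoly \<Rightarrow> ('i \<Rightarrow> complex) \<Rightarrow> complex" where
  "poly_eval p x =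
    (\<Sum>m\<in>Poly_Mapping.keys p. Poly_Mapping.lookup p m *
      (\<Prod>i\<in>Poly_Mapping.keys m. x i ^ Poly_Mapping.lookup m i))"

definition polys_in :: "'i set \<Rightarrow> 'i mpoly set" where
  "polys_in E = {p. \<forall>m\<in>Poly_Mapping.keys p. Poly_Mapping.keys m \<subseteq> E}"

definition vanishing_ideal :: "'i set \<Rightarrow> ('i \<Rightarrow> complex) set \<Rightarrow> 'i mpoly set" where
  "vanishing_ideal I Y = {p \<in> polys_in I. \<forall>y\<in>Y. poly_eval p y = 0}"

definition zariski_closure :: "'i set \<Rightarrow> ('i \<Rightarrow> complex) set \<Rightarrow> ('i \<Rightarrow> complex) set" where
  "zariski_closure I S = {x \<in> affine_space I. \<forall>p\<in>vanishing_ideal I S. poly_eval p x = 0}"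

definition cone_over :: "('i \<Rightarrow> complex) set \<Rightarrow> ('i \<Rightarrow> complex) set" where
  "cone_over S = {\<lambda>i. c * x i | c x. x \<in> S}"

definition secant_variety :: "'i set \<Rightarrow> ('i \<Rightarrow> complex) set \<Rightarrow> ('i \<Rightarrow> complex) set" where
  "secant_variety I X = zariski_closure I {\<lambda>i. x i + y i | x y. x \<in> X \<and> y \<in> X}"

text \<open>A matroid is given by its ground set and its family of independent sets.\<close>

type_synonym 'i matroid = "'i set \<times> 'i set set"

definition algebraic_matroid :: "'i set \<Rightarrow> ('i \<Rightarrow> complex) set \<Rightarrow> 'i matroid" where
  "algebraic_matroid I Y = (I, {E. E \<subseteq> I \<and> vanishing_ideal I Y \<inter> polys_in E = {0}})"

definition matroid_union :: "'i matroid \<Rightarrow> 'i matroid \<Rightarrow> 'i matroid" where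
  "matroid_union M N = (fst M \<union> fst N, {A \<union> B | A B. A \<in> snd M \<and> B \<in> snd N})"

definition lattice_polygon :: "(real \<times> real) set \<Rightarrow> bool" where
  "lattice_polygon P \<longleftrightarrow>
    (\<exists>V. finite V \<and> V \<subseteq> \<int> \<times> \<int> \<and> P = convex hull V) \<and> aff_dim P = 2"

definition lattice_points :: "(real \<times> real) set \<Rightarrow> (int \<times> int) set" where
  "lattice_points P = {m. map_prod real_of_int real_of_int m \<in> P}"

definition monomial_point ::
    "(int \<times> int) set \<Rightarrow> complex \<Rightarrow> complex \<Rightarrow> (int \<times> int) \<Rightarrow> complex" where
  "monomial_point A t u = (\<lambda>m. if m \<in> A then t powi fst m * u powi snd m else 0)"

text \<open>The affine cone over the projective toric surface of \<open>P\<close>: the cone is taken before the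
  closure, since a cone over a Zariski closed subset of affine space need not be closed.\<close>

definition toric_cone :: "(real \<times> real) set \<Rightarrow> (int \<times> int \<Rightarrow> complex) set" where
  "toric_cone P = zariski_closure (lattice_points P)
    (cone_over {monomial_point (lattice_points P) t u | t u. t \<noteq> 0 \<and> u \<noteq> 0})"

end

theory Submission imports Defs begin

text \<open>The six lattice points of the triangle index the entries of a symmetric \<open>3 \<times> 3\<close> matrix.
  On the cone over \<open>X\<close> its \<open>2 \<times> 2\<close> minors vanish, so on sums of two points its determinant
  vanishes, and the six coordinates are dependent in the matroid of the secant variety. On the
  other hand the six points split into two affinely independent triples, on each of which the
  parametrization of the torus cone is surjective onto the points with nonzero coordinates, so that
  the two triples are independent in the matroid of \<open>X\<close>.\<close>

section \<open>Evaluation of polynomials\<close>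

lemma poly_eval_superset:
  assumes "finite S" "Poly_Mapping.keys p \<subseteq> S"
  shows "poly_eval p x = (\<Sum>m\<in>S. Poly_Mapping.lookup p m *
      (\<Prod>i\<in>Poly_Mapping.keys m. x i ^ Poly_Mapping.lookup m i))"
  unfolding poly_eval_def
  by (rule sum.mono_neutral_left) (use assms in \<open>auto simp: in_keys_iff\<close>)

lemma poly_eval_0 [simp]: "poly_eval 0 x = 0"
  by (simp add: poly_eval_def)

lemma poly_eval_add: "poly_eval (p + q) x = poly_eval p x + poly_eval q x"
proof -
  let ?S = "Poly_Mapping.keys p \<union> Poly_Mapping.keys q"
  have "Poly_Mapping.keys (p + q) \<subseteq> ?S"
    by (rule Poly_Mapping.keys_add)
  then show ?thesis
    by (subst (1 2 3) poly_eval_superset[of ?S])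
      (auto simp: lookup_add sum.distrib algebra_simps)
qed

lemma monomial_eval_superset:
  fixes x :: "'i \<Rightarrow> complex"
  assumes "finite S" "Poly_Mapping.keys m \<subseteq> S"
  shows "(\<Prod>i\<in>Poly_Mapping.keys m. x i ^ Poly_Mapping.lookup m i) =
    (\<Prod>i\<in>S. x i ^ Poly_Mapping.lookup m i)"
  by (rule prod.mono_neutral_left) (use assms in \<open>auto simp: in_keys_iff\<close>)

lemma monomial_eval_add:
  fixes x :: "'i \<Rightarrow> complex"
  shows "(\<Prod>i\<in>Poly_Mapping.keys (m + n). x i ^ Poly_Mapping.lookup (m + n) i) =
    (\<Prod>i\<in>Poly_Mapping.keys m. x i ^ Poly_Mapping.lookup m i) *
    (\<Prod>i\<in>Poly_Mapping.keys n. x i ^ Poly_Mapping.lookup n i)"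
proof -
  let ?S = "Poly_Mapping.keys m \<union> Poly_Mapping.keys n"
  have "Poly_Mapping.keys (m + n) \<subseteq> ?S"
    by (rule Poly_Mapping.keys_add)
  then show ?thesis
    by (subst (1 2 3) monomial_eval_superset[of ?S])
      (auto simp: lookup_add prod.distrib power_add)
qed

lemma poly_eval_single:
  "poly_eval (Poly_Mapping.single m c) x =
    c * (\<Prod>i\<in>Poly_Mapping.keys m. x i ^ Poly_Mapping.lookup m i)"
  by (subst poly_eval_superset[of "{m}"]) auto

lemma monomial_eval_single:
  fixes x :: "'i \<Rightarrow> complex"
  shows "(\<Prod>i\<in>Poly_Mapping.keys (Poly_Mapping.single j k).
    x i ^ Poly_Mapping.lookup (Poly_Mapping.single j k) i) = x j ^ k"
  by (subst monomial_eval_superset[of "{j}"]) auto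

lemmas poly_eval_simps =
  poly_eval_add poly_eval_single monomial_eval_add monomial_eval_single

lemma polys_in_add: "p \<in> polys_in E \<Longrightarrow> q \<in> polys_in E \<Longrightarrow> p + q \<in> polys_in E"
  using Poly_Mapping.keys_add[of p q] unfolding polys_in_def by blast

lemma polys_in_single: "Poly_Mapping.keys m \<subseteq> E \<Longrightarrow> Poly_Mapping.single m c \<in> polys_in E"
  by (auto simp: polys_in_def)

lemma keys_add_subset:
  "Poly_Mapping.keys m \<subseteq> E \<Longrightarrow> Poly_Mapping.keys n \<subseteq> E \<Longrightarrow> Poly_Mapping.keys (m + n) \<subseteq> E"
  using Poly_Mapping.keys_add[of m n] by blast

lemma keys_single_subset: "j \<in> E \<Longrightarrow> Poly_Mapping.keys (Poly_Mapping.single j k) \<subseteq> E"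
  by auto

lemmas polys_in_intros = polys_in_add polys_in_single keys_add_subset keys_single_subset

lemma polys_in_mono: "E \<subseteq> F \<Longrightarrow> polys_in E \<subseteq> polys_in F"
  unfolding polys_in_def by blast

section \<open>Polynomials vanishing on the torus\<close>

text \<open>A nonzero coefficient would leave only finitely many roots, whereas every nonzero
  complex number is one.\<close>

lemma polyfun_coeff_0:
  fixes c :: "nat \<Rightarrow> complex"
  assumes "\<And>t. t \<noteq> 0 \<Longrightarrow> (\<Sum>k\<le>n. c k * t ^ k) = 0" and "k \<le> n"
  shows "c k = 0"
proof (rule ccontr)
  assume "c k \<noteq> 0"
  then have "finite {t. (\<Sum>k\<le>n. c k * t ^ k) = 0}"
    using assms(2) by (subst polyfun_finite_roots) auto
  moreover have "- {0} \<subseteq> {t. (\<Sum>k\<le>n. c k * t ^ k) = 0}"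
    using assms(1) by auto
  ultimately have "finite (- {0 :: complex})"
    by (rule rev_finite_subset)
  then show False
    by (metis finite_compl finite.emptyI finite_insert infinite_UNIV_char_0)
qed

text \<open>Induction on the variables: with the others fixed, the sum is a univariate polynomial in
  the new one, so each coefficient, again a combination of monomials, vanishes. The abstract index
  type lets \<open>S\<close> shrink while the exponents \<open>e\<close> stay unchanged.\<close>

lemma monomials_linearly_independent:
  fixes e :: "'k \<Rightarrow> 'i \<Rightarrow> nat" and c :: "'k \<Rightarrow> complex"
  assumes "finite E" "finite S"
    and "\<And>m n. m \<in> S \<Longrightarrow> n \<in> S \<Longrightarrow> (\<forall>i\<in>E. e m i = e n i) \<Longrightarrow> m = n"
    and "\<And>x :: 'i \<Rightarrow> complex. (\<forall>i\<in>E. x i \<noteq> 0) \<Longrightarrow> (\<Sum>m\<in>S. c m * (\<Prod>i\<in>E. x i ^ e m i)) = 0"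
    and "m \<in> S"
  shows "c m = 0"
  using assms
proof (induction E arbitrary: S m rule: finite_induct)
  case empty
  then have "S = {m}" by blast
  with empty.prems(3)[of "\<lambda>_. 1"] show ?case by simp
next
  case (insert j E)
  \<comment> \<open>Once the exponent of \<open>j\<close> is fixed, the exponents on
    \<open>E\<close> alone separate the remaining indices.\<close>
  let ?T = "{n \<in> S. e n j = e m j}"
  show ?case
  proof (rule insert.IH[of ?T])
    show "finite ?T" "m \<in> ?T" using insert.prems by auto
    show "m1 = m2" if "m1 \<in> ?T" "m2 \<in> ?T" "\<forall>i\<in>E. e m1 i = e m2 i" for m1 m2
      using that by (intro insert.prems(2)) auto
    fix x :: "'i \<Rightarrow> complex" assume x: "\<forall>i\<in>E. x i \<noteq> 0"
    define N where "N = Max ((\<lambda>n. e n j) ` S)"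
    have N: "e n j \<le> N" if "n \<in> S" for n
      unfolding N_def using that insert.prems(1) by (intro Max_ge) auto
    \<comment> \<open>\<open>?d k\<close> is the coefficient of \<open>t ^ k\<close> when the
      variable \<open>j\<close> takes the value \<open>t\<close>; \<open>N\<close> bounds the
      degree.\<close>
    let ?d = "\<lambda>k. \<Sum>n\<in>{n \<in> S. e n j = k}. c n * (\<Prod>i\<in>E. x i ^ e n i)"
    show "?d (e m j) = 0"
    proof (rule polyfun_coeff_0[of ?d N])
      fix t :: complex assume t: "t \<noteq> 0"
      have "(\<Sum>k\<le>N. ?d k * t ^ k) =
        (\<Sum>k\<le>N. \<Sum>n\<in>{n \<in> S. e n j = k}. c n * (\<Prod>i\<in>E. x i ^ e n i) * t ^ e n j)"
        unfolding sum_distrib_right by (intro sum.cong) auto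
      also have "\<dots> = (\<Sum>n\<in>S. c n * (\<Prod>i\<in>E. x i ^ e n i) * t ^ e n j)"
        by (rule sum.group) (use insert.prems(1) N in auto)
      also have "\<dots> = (\<Sum>n\<in>S. c n * (\<Prod>i\<in>insert j E. (x(j := t)) i ^ e n i))"
      proof (intro sum.cong refl)
        fix n
        have "(\<Prod>i\<in>E. x i ^ e n i) = (\<Prod>i\<in>E. (x(j := t)) i ^ e n i)"
          using insert.hyps(2) by (intro prod.cong) auto
        then show "c n * (\<Prod>i\<in>E. x i ^ e n i) * t ^ e n j =
          c n * (\<Prod>i\<in>insert j E. (x(j := t)) i ^ e n i)"
          using insert.hyps by (simp add: mult_ac)
      qed
      also have "\<dots> = 0"
        by (rule insert.prems(3)) (use x t in auto)
      finally show "(\<Sum>k\<le>N. ?d k * t ^ k) = 0" .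
    qed (use N insert.prems(4) in auto)
  qed
qed

text \<open>\<open>Y\<close> need not contain the torus: since \<open>p\<close> involves only
  variables in \<open>E\<close>, it is enough that the projection of \<open>Y\<close> to these
  coordinates covers it.\<close>

lemma mpoly_eq_0_if_vanishes_on_torus:
  fixes Y :: "('i \<Rightarrow> complex) set"
  assumes "finite E" "p \<in> polys_in E"
    and dense: "\<And>x. (\<forall>i\<in>E. x i \<noteq> 0) \<Longrightarrow> \<exists>y\<in>Y. \<forall>i\<in>E. y i = x i"
    and van: "\<And>y. y \<in> Y \<Longrightarrow> poly_eval p y = 0"
  shows "p = 0"
proof -
  have keys: "Poly_Mapping.keys m \<subseteq> E" if "m \<in> Poly_Mapping.keys p" for m
    using assms(2) that by (auto simp: polys_in_def)
  have "Poly_Mapping.lookup p m = 0" if "m \<in> Poly_Mapping.keys p" for m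
  proof (rule monomials_linearly_independent[of E "Poly_Mapping.keys p" Poly_Mapping.lookup])
    fix m n assume "m \<in> Poly_Mapping.keys p" "n \<in> Poly_Mapping.keys p"
      "\<forall>i\<in>E. Poly_Mapping.lookup m i = Poly_Mapping.lookup n i"
    then show "m = n"
      using keys[of m] keys[of n] by (intro poly_mapping_eqI) (metis in_keys_iff subsetD)
  next
    fix x :: "'i \<Rightarrow> complex" assume "\<forall>i\<in>E. x i \<noteq> 0"
    then obtain y where y: "y \<in> Y" "\<forall>i\<in>E. y i = x i"
      using dense by blast
    have "(\<Sum>m\<in>Poly_Mapping.keys p. Poly_Mapping.lookup p m *
        (\<Prod>i\<in>E. x i ^ Poly_Mapping.lookup m i)) = poly_eval p y"
      unfolding poly_eval_def
    proof (intro sum.cong refl arg_cong2[of _ _ _ _ "(*)"])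
      fix m assume "m \<in> Poly_Mapping.keys p"
      then show "(\<Prod>i\<in>E. x i ^ Poly_Mapping.lookup m i) =
          (\<Prod>i\<in>Poly_Mapping.keys m. y i ^ Poly_Mapping.lookup m i)"
        using y(2) keys assms(1) by (subst monomial_eval_superset[of E]) auto
    qed
    with y(1) van show "(\<Sum>m\<in>Poly_Mapping.keys p. Poly_Mapping.lookup p m *
        (\<Prod>i\<in>E. x i ^ Poly_Mapping.lookup m i)) = 0" by simp
  qed (use assms(1) that in auto)
  then show ?thesis
    by (intro poly_mapping_eqI) (metis in_keys_iff lookup_zero)
qed

section \<open>The toric cone and its secant variety\<close>

lemma zariski_closure_superset: "S \<subseteq> affine_space I \<Longrightarrow> S \<subseteq> zariski_closure I S"
  by (auto simp: zariski_closure_def vanishing_ideal_def)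

lemma zariski_closure_eqI:
  assumes "x \<in> zariski_closure I S" "p \<in> polys_in I" "\<And>y. y \<in> S \<Longrightarrow> poly_eval p y = 0"
  shows "poly_eval p x = 0"
  using assms by (auto simp: zariski_closure_def vanishing_ideal_def)

lemma toric_cone_point:
  assumes "t \<noteq> 0" "u \<noteq> 0"
  shows "(\<lambda>i. c * monomial_point (lattice_points P) t u i) \<in> toric_cone P"
  unfolding toric_cone_def
proof (rule subsetD[OF zariski_closure_superset])
  show "(\<lambda>i. c * monomial_point (lattice_points P) t u i) \<in>
    cone_over {monomial_point (lattice_points P) t u | t u. t \<noteq> 0 \<and> u \<noteq> 0}"
    unfolding cone_over_def using assms by blast
qed (auto simp: affine_space_def cone_over_def monomial_point_def)

text \<open>At a scaled monomial point both sides are the squared scalar times the monomial with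
  exponent \<open>p + q\<close>, and a polynomial identity passes to the closure.\<close>

lemma toric_cone_binomial:
  assumes x: "x \<in> toric_cone P"
    and pts: "{p, q, r, s} \<subseteq> lattice_points P" and eq: "p + q = r + s"
  shows "x p * x q = x r * x s"
proof -
  let ?m = "\<lambda>p q. Poly_Mapping.single p 1 + Poly_Mapping.single q (1::nat)"
  let ?f = "Poly_Mapping.single (?m p q) 1 + Poly_Mapping.single (?m r s) (-1) :: (int \<times> int) mpoly"
  have "poly_eval ?f x = 0"
  proof (rule zariski_closure_eqI[OF x[unfolded toric_cone_def]])
    show "?f \<in> polys_in (lattice_points P)"
      using pts by (intro polys_in_intros) auto
    fix y assume "y \<in> cone_over {monomial_point (lattice_points P) t u |t u. t \<noteq> 0 \<and> u \<noteq> 0}"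
    then obtain c t u where tu: "t \<noteq> 0" "u \<noteq> 0"
      and y: "y = (\<lambda>i. c * monomial_point (lattice_points P) t u i)"
      by (auto simp: cone_over_def)
    have prod: "y a * y b = c\<^sup>2 * (t powi fst (a + b) * u powi snd (a + b))"
      if "a \<in> lattice_points P" "b \<in> lattice_points P" for a b
      using that tu by (simp add: y monomial_point_def power_int_add power2_eq_square mult_ac)
    show "poly_eval ?f y = 0"
      using pts prod[of p q] prod[of r s] eq by (simp add: poly_eval_simps)
  qed
  then show ?thesis by (simp add: poly_eval_simps)
qed

lemma toric_cone_independent:
  assumes "finite E" "E \<subseteq> lattice_points P"
    and dense: "\<And>x :: int \<times> int \<Rightarrow> complex. (\<forall>i\<in>E. x i \<noteq> 0) \<Longrightarrow>
      \<exists>c t u. t \<noteq> 0 \<and> u \<noteq> 0 \<and> (\<forall>i\<in>E. x i = c * (t powi fst i * u powi snd i))"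
  shows "E \<in> snd (algebraic_matroid (lattice_points P) (toric_cone P))"
proof -
  have "p = 0" if p: "p \<in> vanishing_ideal (lattice_points P) (toric_cone P)" "p \<in> polys_in E" for p
  proof (rule mpoly_eq_0_if_vanishes_on_torus[OF assms(1) p(2), of "toric_cone P"])
    fix x :: "int \<times> int \<Rightarrow> complex" assume "\<forall>i\<in>E. x i \<noteq> 0"
    then obtain c t u where tu: "t \<noteq> 0" "u \<noteq> 0"
      and x: "\<forall>i\<in>E. x i = c * (t powi fst i * u powi snd i)"
      using dense by blast
    then show "\<exists>y\<in>toric_cone P. \<forall>i\<in>E. y i = x i"
      using assms(2) by (intro bexI[OF _ toric_cone_point[OF tu, of c]])
        (auto simp: monomial_point_def)
  qed (use p(1) in \<open>auto simp: vanishing_ideal_def\<close>)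
  moreover have "0 \<in> vanishing_ideal (lattice_points P) (toric_cone P) \<inter> polys_in E"
    by (simp add: vanishing_ideal_def polys_in_def)
  ultimately show ?thesis
    using assms(2) by (auto simp: algebraic_matroid_def)
qed

text \<open>Vanishing on sums of two points passes to their Zariski closure, so one nonzero
  polynomial certifies dependence.\<close>

lemma secant_dependent:
  assumes "E \<subseteq> I" "p \<in> polys_in E" "p \<noteq> 0"
    and "\<And>x y. x \<in> X \<Longrightarrow> y \<in> X \<Longrightarrow> poly_eval p (\<lambda>i. x i + y i) = 0"
  shows "E \<notin> snd (algebraic_matroid I (secant_variety I X))"
proof -
  have pI: "p \<in> polys_in I"
    using polys_in_mono[OF assms(1)] assms(2) by blast
  have "poly_eval p z = 0" if "z \<in> secant_variety I X" for z
    using that unfolding secant_variety_def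
    by (rule zariski_closure_eqI[OF _ pI]) (use assms(4) in auto)
  with pI have "p \<in> vanishing_ideal I (secant_variety I X)"
    by (auto simp: vanishing_ideal_def)
  with assms(2,3) show ?thesis
    by (auto simp: algebraic_matroid_def)
qed

section \<open>The Veronese triangle\<close>

text \<open>The entries \<open>a, b, c, d, e, f\<close> are those of the symmetric matrix with rows \<open>a b c\<close>,
  \<open>b d e\<close> and \<open>c e f\<close>. Every mixed term in the expansion of the determinant of a sum of two matrices
  is an entry of one of them times a \<open>2 \<times> 2\<close> minor of the other.\<close>

lemma symmetric_det_sum_rank_one:
  fixes a b c d e f a' b' c' d' e' f' :: complex
  assumes "a * d = b * b" "a * f = c * c" "d * f = e * e"
    and "a * e = b * c" "b * f = c * e" "c * d = b * e"
    and "a' * d' = b' * b'" "a' * f' = c' * c'" "d' * f' = e' * e'"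
    and "a' * e' = b' * c'" "b' * f' = c' * e'" "c' * d' = b' * e'"
  shows "(a + a') * (d + d') * (f + f') + 2 * ((b + b') * (c + c') * (e + e'))
    - (a + a') * (e + e')\<^sup>2 - (f + f') * (b + b')\<^sup>2 - (d + d') * (c + c')\<^sup>2 = 0"
proof -
  \<comment> \<open>\<open>D\<close> is the determinant and \<open>T\<close> its differential at the
    unprimed matrix in the primed direction: up to constant factors, the coefficients of the primed
    entries are minors of the unprimed matrix.\<close>
  define D where "D = (\<lambda>a b c d e f. a * d * f + 2 * (b * c * e) - a * e\<^sup>2 - f * b\<^sup>2 - d * c\<^sup>2 :: complex)"
  define T where "T = (\<lambda>a b c d e f a' b' c' d' e' f'. a' * (d * f - e * e) + d' * (a * f - c * c)
    + f' * (a * d - b * b) - 2 * b' * (b * f - c * e) - 2 * c' * (c * d - b * e)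
    - 2 * e' * (a * e - b * c) :: complex)"
  have "D (a + a') (b + b') (c + c') (d + d') (e + e') (f + f') =
    D a b c d e f + T a b c d e f a' b' c' d' e' f'
    + T a' b' c' d' e' f' a b c d e f + D a' b' c' d' e' f'"
    unfolding D_def T_def by algebra
  moreover have "T a b c d e f a' b' c' d' e' f' = 0" "T a' b' c' d' e' f' a b c d e f = 0"
    unfolding T_def using assms by simp_all
  \<comment> \<open>Euler's identity for a cubic form, which reduces the two pure determinants to
    vanishing minors as well.\<close>
  moreover have "3 * D a b c d e f = T a b c d e f a b c d e f"
    "3 * D a' b' c' d' e' f' = T a' b' c' d' e' f' a' b' c' d' e' f'"
    unfolding D_def T_def by algebra+
  moreover have "T a b c d e f a b c d e f = 0" "T a' b' c' d' e' f' a' b' c' d' e' f' = 0"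
    unfolding T_def using assms by simp_all
  ultimately have "D (a + a') (b + b') (c + c') (d + d') (e + e') (f + f') = 0"
    by simp
  then show ?thesis
    unfolding D_def .
qed

text \<open>With \<open>w\<close> running through (0,0), (1,0), (0,1), the matrix entry in row i and
  column j sits at the point (k,l) + w_i + w_j; the points are listed in the order \<open>a\<close>
  to \<open>f\<close>.\<close>

definition veronese_triangle :: "int \<Rightarrow> int \<Rightarrow> (int \<times> int) set" where
  "veronese_triangle k l =
    {(k, l), (k + 1, l), (k, l + 1), (k + 2, l), (k + 1, l + 1), (k, l + 2)}"

lemma veronese_triangle_dependent:
  assumes sub: "veronese_triangle k l \<subseteq> lattice_points P"
  shows "veronese_triangle k l \<notin>
    snd (algebraic_matroid (lattice_points P) (secant_variety (lattice_points P) (toric_cone P)))"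
proof -
  define A B C D E F where pts: "A = (k, l)" "B = (k + 1, l)" "C = (k, l + 1)"
    "D = (k + 2, l)" "E = (k + 1, l + 1)" "F = (k, l + 2)"
  note V = veronese_triangle_def[of k l, folded pts]
  let ?s = "\<lambda>p n. Poly_Mapping.single p (n::nat)"
  \<comment> \<open>\<open>g\<close> is the determinant of the symmetric matrix with rows
    \<open>A B C\<close>, \<open>B D E\<close> and \<open>C E F\<close>.\<close>
  define g :: "(int \<times> int) mpoly" where "g =
    Poly_Mapping.single (?s A 1 + ?s D 1 + ?s F 1) 1
    + Poly_Mapping.single (?s B 1 + ?s C 1 + ?s E 1) 2
    + Poly_Mapping.single (?s A 1 + ?s E 2) (-1)
    + Poly_Mapping.single (?s F 1 + ?s B 2) (-1)
    + Poly_Mapping.single (?s D 1 + ?s C 2) (-1)"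
  have eval: "poly_eval g x = x A * x D * x F + 2 * (x B * x C * x E)
      - x A * (x E)\<^sup>2 - x F * (x B)\<^sup>2 - x D * (x C)\<^sup>2" for x
    by (simp add: g_def poly_eval_simps)
  show ?thesis
  proof (rule secant_dependent[OF sub, of g])
    show "g \<in> polys_in (veronese_triangle k l)"
      unfolding g_def V by (intro polys_in_intros) auto
    \<comment> \<open>This point is the identity matrix.\<close>
    have "poly_eval g (\<lambda>i. if i \<in> {A, D, F} then 1 else 0) = 1"
      unfolding eval by (simp add: pts)
    then show "g \<noteq> 0" by auto
  next
    fix x y assume x: "x \<in> toric_cone P" and y: "y \<in> toric_cone P"
    \<comment> \<open>In each relation the two products have the same sum of lattice points.\<close>
    have minors: "z A * z D = z B * z B" "z A * z F = z C * z C" "z D * z F = z E * z E"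
      "z A * z E = z B * z C" "z B * z F = z C * z E" "z C * z D = z B * z E"
      if z: "z \<in> toric_cone P" for z
      by (rule toric_cone_binomial[OF z]; use sub in \<open>simp add: V pts\<close>)+
    show "poly_eval g (\<lambda>i. x i + y i) = 0"
      unfolding eval by (rule symmetric_det_sum_rank_one) (fact minors[OF x] minors[OF y])+
  qed
qed

lemma veronese_triangle_union:
  assumes sub: "veronese_triangle k l \<subseteq> lattice_points P"
  shows "\<exists>A B. veronese_triangle k l = A \<union> B \<and>
    A \<in> snd (algebraic_matroid (lattice_points P) (toric_cone P)) \<and>
    B \<in> snd (algebraic_matroid (lattice_points P) (toric_cone P))"
proof (intro exI conjI)
  \<comment> \<open>The differences within \<open>?A\<close> generate the whole lattice, those
    within \<open>?B\<close> a sublattice of index two; hence only \<open>?B\<close> calls for a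
    square root.\<close>
  let ?A = "{(k, l), (k + 1, l), (k + 1, l + 1)}" and ?B = "{(k + 2, l), (k, l + 1), (k, l + 2)}"
  show "veronese_triangle k l = ?A \<union> ?B"
    by (auto simp: veronese_triangle_def)
  show "?A \<in> snd (algebraic_matroid (lattice_points P) (toric_cone P))"
  proof (rule toric_cone_independent)
    fix x :: "int \<times> int \<Rightarrow> complex" assume nz: "\<forall>i\<in>?A. x i \<noteq> 0"
    \<comment> \<open>Successive points of \<open>?A\<close> differ by a unit step, so
      \<open>t\<close> and \<open>u\<close> are ratios of neighbouring coordinates.\<close>
    define t u where tu: "t = x (k + 1, l) / x (k, l)" "u = x (k + 1, l + 1) / x (k + 1, l)"
    have "t \<noteq> 0" "u \<noteq> 0" using nz by (auto simp: tu)
    then show "\<exists>c t u. t \<noteq> 0 \<and> u \<noteq> 0 \<and> (\<forall>i\<in>?A. x i = c * (t powi fst i * u powi snd i))"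
      using nz
      by (intro exI[of _ "x (k, l) / (t powi k * u powi l)"] exI[of _ t] exI[of _ u])
        (auto simp: power_int_add, auto simp: tu)
  qed (use sub in \<open>auto simp: veronese_triangle_def\<close>)
  show "?B \<in> snd (algebraic_matroid (lattice_points P) (toric_cone P))"
  proof (rule toric_cone_independent)
    fix x :: "int \<times> int \<Rightarrow> complex" assume nz: "\<forall>i\<in>?B. x i \<noteq> 0"
    define a b c where abc: "a = x (k + 2, l)" "b = x (k, l + 1)" "c = x (k, l + 2)"
    have abc_nz: "a \<noteq> 0" "b \<noteq> 0" "c \<noteq> 0" using nz by (auto simp: abc)
    define t u where tu: "t = csqrt (a * c) / b" "u = c / b"
    have tu_nz: "t \<noteq> 0" "u \<noteq> 0" using abc_nz by (auto simp: tu)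
    \<comment> \<open>The scalar \<open>b\<^sup>2 / c\<close> is the value that the parametrization
      takes at the corner (k,l); dividing it below by \<open>t powi k * u powi l\<close> accounts
      for the translation.\<close>
    have "a = b\<^sup>2 / c * t\<^sup>2" "b = b\<^sup>2 / c * u" "c = b\<^sup>2 / c * u\<^sup>2"
      using abc_nz by (auto simp: tu power_divide) (auto simp: power2_eq_square)
    then show "\<exists>c t u. t \<noteq> 0 \<and> u \<noteq> 0 \<and> (\<forall>i\<in>?B. x i = c * (t powi fst i * u powi snd i))"
      using tu_nz
      by (intro exI[of _ "b\<^sup>2 / c / (t powi k * u powi l)"] exI[of _ t] exI[of _ u])
        (auto simp: power_int_add abc)
  qed (use sub in \<open>auto simp: veronese_triangle_def\<close>)
qed

text \<open>Since \<open>v\<close> is an extreme point of the triangle, it is one of the integral points spanning it.\<close>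

lemma translated_triangle_vertex_integral:
  fixes v :: "real \<times> real"
  assumes "lattice_polygon ((\<lambda>x. v + x) ` (convex hull {(0, 0), (2, 0), (0, 2)}))"
  shows "v \<in> \<int> \<times> \<int>"
proof -
  let ?T = "convex hull {(0, 0), (2, 0), (0, 2)} :: (real \<times> real) set"
  obtain V where V: "V \<subseteq> \<int> \<times> \<int>" "(\<lambda>x. v + x) ` ?T = convex hull V"
    using assms by (auto simp: lattice_polygon_def)
  \<comment> \<open>The triangle lies in the first quadrant, so \<open>v\<close> is the
    coordinatewise minimum of its translate.\<close>
  have "?T \<subseteq> {x. 0 \<le> fst x} \<inter> {x. 0 \<le> snd x}"
  proof (rule hull_minimal)
    show "convex ({x. 0 \<le> fst x} \<inter> {x. 0 \<le> snd x} :: (real \<times> real) set)"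
      by (auto simp: convex_def)
  qed auto
  then have le: "fst v \<le> fst y \<and> snd v \<le> snd y" if "y \<in> convex hull V" for y
    using that unfolding V(2)[symmetric] by auto
  have "(0, 0) \<in> ?T" by (rule hull_inc) simp
  then have "v \<in> convex hull V"
    unfolding V(2)[symmetric] by (force simp: zero_prod_def[symmetric])
  moreover have "v \<notin> open_segment x y" if xy: "x \<in> convex hull V" "y \<in> convex hull V" for x y
  proof
    assume "v \<in> open_segment x y"
    then obtain u where u: "0 < u" "u < 1" "v = (1 - u) *\<^sub>R x + u *\<^sub>R y" "x \<noteq> y"
      by (auto simp: in_segment)
    \<comment> \<open>A proper convex combination of two numbers that are at least \<open>r\<close>
      equals \<open>r\<close> only if both do.\<close>
    have eq: "p = r \<and> q = r" if "r \<le> p" "r \<le> q" "r = (1 - u) * p + u * q" for p q r :: real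
    proof -
      have "(1 - u) * (p - r) + u * (q - r) = 0"
        using that(3) by (simp add: algebra_simps)
      then have "(1 - u) * (p - r) = 0 \<and> u * (q - r) = 0"
        using that u by (subst add_nonneg_eq_0_iff[symmetric]) auto
      then show ?thesis using u by auto
    qed
    have "x = v \<and> y = v"
      using eq[of "fst v" "fst x" "fst y"] eq[of "snd v" "snd x" "snd y"] le[OF xy(1)] le[OF xy(2)]
      by (simp add: prod_eq_iff u(3))
    then show False using u(4) by simp
  qed
  ultimately have "v extreme_point_of (convex hull V)"
    by (auto simp: extreme_point_of_def)
  then show ?thesis
    using V(1) extreme_point_of_convex_hull by blast
qed

lemma veronese_triangle_subset:
  assumes "(\<lambda>x. (of_int k, of_int l) + x) ` (convex hull {(0, 0), (2, 0), (0, 2)}) \<subseteq> P"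
  shows "veronese_triangle k l \<subseteq> lattice_points P"
proof -
  let ?H = "{(0, 0), (2, 0), (0, 2)} :: (real \<times> real) set"
  have vertices: "?H \<subseteq> convex hull ?H" by (rule hull_subset)
  \<comment> \<open>The three lattice points other than the vertices are the midpoints of the
    edges.\<close>
  have mid: "midpoint x y \<in> convex hull ?H" if "x \<in> ?H" "y \<in> ?H" for x y
    using closed_segment_subset_convex_hull[of x ?H y] that vertices midpoint_in_closed_segment
    by blast
  have "{(0, 0), (1, 0), (0, 1), (2, 0), (1, 1), (0, 2)} \<subseteq> convex hull ?H"
    using vertices mid[of "(0, 0)" "(2, 0)"] mid[of "(0, 0)" "(0, 2)"] mid[of "(2, 0)" "(0, 2)"]
    by (auto simp: midpoint_def)
  then have "(\<lambda>x. (of_int k, of_int l) + x) ` {(0, 0), (1, 0), (0, 1), (2, 0), (1, 1), (0, 2)} \<subseteq> P"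
    using assms by (meson image_mono order_trans)
  then show ?thesis
    by (simp add: veronese_triangle_def lattice_points_def)
qed

theorem theorem4p2:
  fixes P Q :: "(real \<times> real) set" and v :: "real \<times> real"
  assumes "lattice_polygon P"
    and "lattice_polygon Q"
    and "Q = (\<lambda>x. v + x) ` (convex hull {(0, 0), (2, 0), (0, 2)})"
    and "Q \<subseteq> P"
  shows "algebraic_matroid (lattice_points P) (secant_variety (lattice_points P) (toric_cone P))
    \<noteq> matroid_union (algebraic_matroid (lattice_points P) (toric_cone P))
        (algebraic_matroid (lattice_points P) (toric_cone P))"
proof -
  \<comment> \<open>The translation vector is a priori real; integrality comes from \<open>Q\<close>
    being a lattice polygon.\<close>
  have "v \<in> \<int> \<times> \<int>"
    using assms(2) unfolding assms(3) by (rule translated_triangle_vertex_integral)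
  then obtain k l where v: "v = (of_int k, of_int l)"
    by (auto elim!: Ints_cases)
  have sub: "veronese_triangle k l \<subseteq> lattice_points P"
    using assms(4) unfolding assms(3) v by (rule veronese_triangle_subset)
  \<comment> \<open>The six points separate the matroids: they are independent in the union but
    dependent for the secant variety.\<close>
  have "veronese_triangle k l \<in> snd (matroid_union
      (algebraic_matroid (lattice_points P) (toric_cone P))
      (algebraic_matroid (lattice_points P) (toric_cone P)))"
    using veronese_triangle_union[OF sub] by (auto simp: matroid_union_def)
  with veronese_triangle_dependent[OF sub] show ?thesis
    by metis
qed

end
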